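(* Let $0<p<\infty$ and let $\rho=\frac{1}{2}(I_2+r_1\sigma_1+r_2\sigma_2+r_3\sigma_3)$ be a 1-qubit density operator with Bloch vector $\vec r=(r_1,r_2,r_3)\in\mathbb{R}^3$. Let $C_p(\rho)=\min_{\iota\in\mathcal{I}}\|\rho-\iota\|_p$ be its $p$-norm quantum coherence, where $\mathcal{I}$ is the set of incoherent 1-qubit states. Then $$C_p(\rho)=2^{(1-p)/p}\sqrt{r_1^2+r_2^2}.$$
   Context: $I_2$ is the $2\times 2$ identity matrix and $\sigma_1=\begin{pmatrix}0&1\\1&0\end{pmatrix}$, $\sigma_2=\begin{pmatrix}0&-i\\i&0\end{pmatrix}$, $\sigma_3=\begin{pmatrix}1&0\\0&-1\end{pmatrix}$ are the Pauli matrices. A 1-qubit density operator is a positive semidefinite Hermitian $2\times2$ complex matrix of trace $1$; each can be written as $\frac12(I_2+\vec r\cdot\vec\sigma)$ with $\vec r\in\mathbb{R}^3$, $\|\vec r\|_2\le 1$. An incoherent 1-qubit state is a density operator that is diagonal in the computational (standard) basis, i.e. of the form $\iota=\frac12(I_2+\iota_3\sigma_3)$ with $\iota_3\in\mathbb{R}$, $|\iota_3|\le 1$; $\mathcal{I}$ denotes the set of all of these. For a complex square matrix $A$, $\|A\|_p=\left(\mathrm{tr}\left(\left(\sqrt{A^\dagger A}\right)^p\right)\right)^{1/p}$ (for $0<p<1$ this is only a quasi-norm, but the same formula is used). *)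

theory Defs
  imports "HOL-Analysis.Analysis"
begin

definition adjoint_mat :: "complex^'n^'m \<Rightarrow> complex^'m^'n" where
  "adjoint_mat A = (\<chi> i j. cnj (A $ j $ i))"

definition hermitian_mat :: "complex^'n^'n \<Rightarrow> bool" where
  "hermitian_mat A \<longleftrightarrow> adjoint_mat A = A"

definition unitary_mat :: "complex^'n^'n \<Rightarrow> bool" where
  "unitary_mat U \<longleftrightarrow> adjoint_mat U ** U = mat 1 \<and> U ** adjoint_mat U = mat 1"

definition psd_mat :: "complex^'n^'n \<Rightarrow> bool" where
  "psd_mat A \<longleftrightarrow> hermitian_mat A \<and>
     (\<forall>v :: complex^'n. 0 \<le> Re (\<Sum>i\<in>UNIV. cnj (v $ i) * (A *v v) $ i))"

definition diag_mat_real :: "('n \<Rightarrow> real) \<Rightarrow> complex^'n^'n" where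
  "diag_mat_real d = (\<chi> i j. if i = j then complex_of_real (d i) else 0)"

(* Functional calculus f(A) = U f(D) U* for a unitary diagonalisation A = U D U*.  For Hermitian A
   the result does not depend on U and D; for other A the value is unspecified. *)
definition mat_fun :: "(real \<Rightarrow> real) \<Rightarrow> complex^'n^'n \<Rightarrow> complex^'n^'n" where
  "mat_fun f A = (THE B. \<exists>U d. unitary_mat U \<and>
     A = U ** diag_mat_real d ** adjoint_mat U \<and>
     B = U ** diag_mat_real (\<lambda>i. f (d i)) ** adjoint_mat U)"

definition mat_abs :: "complex^'n^'n \<Rightarrow> complex^'n^'n" where
  "mat_abs A = mat_fun sqrt (adjoint_mat A ** A)"

(* The trace below is a nonnegative real number; Re only changes its type.
   For p > 0 we have 0 powr p = 0, so zero singular values contribute nothing. *)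
definition schatten_norm :: "real \<Rightarrow> complex^'n^'n \<Rightarrow> real" where
  "schatten_norm p A = Re (trace (mat_fun (\<lambda>x. x powr p) (mat_abs A))) powr (1 / p)"

definition pauli1 :: "complex^2^2" where
  "pauli1 = vector [vector [0, 1], vector [1, 0]]"

definition pauli2 :: "complex^2^2" where
  "pauli2 = vector [vector [0, - \<i>], vector [\<i>, 0]]"

definition pauli3 :: "complex^2^2" where
  "pauli3 = vector [vector [1, 0], vector [0, - 1]]"

definition density_op :: "complex^'n^'n \<Rightarrow> bool" where
  "density_op \<rho> \<longleftrightarrow> psd_mat \<rho> \<and> trace \<rho> = 1"

definition incoherent_states :: "(complex^2^2) set" where
  "incoherent_states = {\<iota>. density_op \<iota> \<and> (\<forall>i j. i \<noteq> j \<longrightarrow> \<iota> $ i $ j = 0)}"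

(* Written as an infimum; that it is a minimum has to be asserted separately. *)
definition coherence :: "real \<Rightarrow> complex^2^2 \<Rightarrow> real" where
  "coherence p \<rho> = (INF \<iota>\<in>incoherent_states. schatten_norm p (\<rho> - \<iota>))"

end

theory Submission
  imports Defs
begin

text \<open>For incoherent \<open>\<iota>\<close> the matrix \<open>A = \<rho> - \<iota>\<close> is Hermitian and traceless, so
  \<open>A\<^sup>\<dagger>A\<close> is the scalar matrix \<open>s\<^sup>2 I\<close> with \<open>4 s\<^sup>2 = r1\<^sup>2 + r2\<^sup>2 + (r3 - t)\<^sup>2\<close>, where \<open>t\<close> is the third
  Bloch coordinate of \<open>\<iota>\<close>. Both singular values equal \<open>s\<close>, hence the p-norm is \<open>2 powr (1/p) * s\<close>, and
  the minimum is at \<open>t = r3\<close>, the dephased state.\<close>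

lemma adjoint_mat_1: "adjoint_mat (mat 1 :: complex^'n^'n) = mat 1"
  by (auto simp: adjoint_mat_def mat_def vec_eq_iff)

lemma diag_mat_real_const: "diag_mat_real (\<lambda>_. c) = mat (complex_of_real c)"
  by (simp add: diag_mat_real_def mat_def)

lemma mat_matrix_mul_commute: "mat c ** A = A ** mat (c :: complex)" for A :: "complex^'n^'n"
  by (simp add: matrix_matrix_mult_def mat_def vec_eq_iff if_distrib if_distribR sum.delta
      sum.delta' mult.commute cong: if_cong)

text \<open>Scalar matrices are central, so conjugating \<open>mat c\<close> by any unitary gives
  \<open>mat c\<close> back. Hence every diagonalisation has the constant diagonal \<open>c\<close>,
  which is the uniqueness that \<open>THE\<close> in \<open>mat_fun\<close> asks for.\<close>

lemma mat_fun_scalar: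
  "mat_fun f (mat (complex_of_real c) :: complex^'n^'n) = mat (complex_of_real (f c))"
  unfolding mat_fun_def
proof (rule the_equality, goal_cases)
  case 1
  show ?case
    by (intro exI[of _ "mat 1"] exI[of _ "\<lambda>_. c"])
       (simp add: unitary_mat_def adjoint_mat_1 diag_mat_real_const)
next
  case (2 B)
  then obtain U :: "complex^'n^'n" and d where U: "unitary_mat U"
    and c: "mat (complex_of_real c) = U ** diag_mat_real d ** adjoint_mat U"
    and B: "B = U ** diag_mat_real (\<lambda>i. f (d i)) ** adjoint_mat U"
    by blast
  have UU: "adjoint_mat U ** U = mat 1" "U ** adjoint_mat U = mat 1"
    using U by (auto simp: unitary_mat_def)
  have "diag_mat_real d = (adjoint_mat U ** U) ** diag_mat_real d ** (adjoint_mat U ** U)"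
    by (simp add: UU)
  also have "\<dots> = adjoint_mat U ** mat (complex_of_real c) ** U"
    by (simp add: c matrix_mul_assoc)
  also have "\<dots> = mat (complex_of_real c) ** (adjoint_mat U ** U)"
    by (simp add: mat_matrix_mul_commute[symmetric] matrix_mul_assoc)
  finally have "diag_mat_real d = mat (complex_of_real c)" by (simp add: UU)
  then have "d i = c" for i
    by (auto simp: diag_mat_real_def mat_def vec_eq_iff dest!: spec[of _ i])
  then have "B = U ** mat (complex_of_real (f c)) ** adjoint_mat U"
    by (simp add: B diag_mat_real_const)
  also have "\<dots> = mat (complex_of_real (f c)) ** (U ** adjoint_mat U)"
    by (simp add: mat_matrix_mul_commute[symmetric] matrix_mul_assoc)
  finally show ?case by (simp add: UU)
qed

text \<open>All singular values equal \<open>s\<close>. Both uses of \<open>mat_fun\<close>, the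
  root of the Gram matrix and the power of its root, are then at scalar matrices.\<close>

lemma schatten_norm_scalar_gram:
  fixes A :: "complex^'n^'n"
  assumes "adjoint_mat A ** A = mat (complex_of_real (s\<^sup>2))" "0 \<le> s" "0 < p"
  shows "schatten_norm p A = real CARD('n) powr (1 / p) * s"
proof -
  have "mat_abs A = mat (complex_of_real s)"
    using assms(2) by (simp add: mat_abs_def assms(1) mat_fun_scalar del: of_real_power)
  then have "schatten_norm p A = Re (trace (mat (complex_of_real (s powr p)) :: complex^'n^'n)) powr (1 / p)"
    by (simp add: schatten_norm_def mat_fun_scalar)
  also have "\<dots> = (real CARD('n) * s powr p) powr (1 / p)"
    by (simp add: trace_def mat_def)
  \<comment> \<open>The exponents cancel as \<open>p * (1 / p) = 1\<close>, and
    \<open>s powr 1 = s\<close> holds also at \<open>s = 0\<close>.\<close>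
  also have "\<dots> = real CARD('n) powr (1 / p) * s"
    using assms(2,3) by (simp add: powr_mult powr_powr)
  finally show ?thesis .
qed

text \<open>Cayley-Hamilton with trace 0 turns \<open>A ** A\<close> into the scalar -det A = z^2 +
  |w|^2, where w is the upper right entry; Hermiticity makes this the Gram matrix.\<close>

lemma schatten_norm_hermitian_traceless:
  fixes A :: "complex^2^2"
  assumes "A $ 1 $ 1 = complex_of_real z" "A $ 2 $ 2 = - complex_of_real z"
    and "A $ 2 $ 1 = cnj (A $ 1 $ 2)" "0 < p"
  shows "schatten_norm p A = 2 powr (1 / p) * sqrt (z\<^sup>2 + (cmod (A $ 1 $ 2))\<^sup>2)"
proof -
  have "adjoint_mat A ** A = mat (complex_of_real ((sqrt (z\<^sup>2 + (cmod (A $ 1 $ 2))\<^sup>2))\<^sup>2))"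
    using assms(1-3) complex_norm_square[of "A $ 1 $ 2"]
    by (simp add: vec_eq_iff forall_2 matrix_matrix_mult_def adjoint_mat_def mat_def sum_2
        power2_eq_square)
  from schatten_norm_scalar_gram[OF this _ assms(4)] show ?thesis by simp
qed

text \<open>Evaluate the quadratic form at a basis vector. This later ensures that the diagonal part
  of \<rho> is itself a state.\<close>

lemma psd_mat_diag_nonneg:
  fixes A :: "complex^'n^'n"
  assumes "psd_mat A"
  shows "0 \<le> Re (A $ i $ i)"
proof -
  have "0 \<le> Re (\<Sum>j\<in>UNIV. cnj (axis i 1 $ j) * (A *v axis i 1) $ j)"
    using assms by (auto simp: psd_mat_def)
  also have "(\<Sum>j\<in>UNIV. cnj (axis i 1 $ j) * (A *v axis i 1) $ j) = A $ i $ i"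
    by (simp add: axis_def matrix_vector_mult_def if_distrib if_distribR sum.delta sum.delta'
        cong: if_cong)
  finally show ?thesis .
qed

lemma psd_mat_diag_mat_real:
  fixes d :: "'n::finite \<Rightarrow> real"
  assumes "\<And>i. 0 \<le> d i"
  shows "psd_mat (diag_mat_real d)"
proof -
  have "cnj (v $ i) * (diag_mat_real d *v v) $ i = complex_of_real (d i * (cmod (v $ i))\<^sup>2)"
    for v :: "complex^'n" and i
    using complex_norm_square[of "v $ i"]
    by (simp add: diag_mat_real_def matrix_vector_mult_def if_distrib if_distribR sum.delta
        sum.delta' cong: if_cong)
  then show ?thesis
    using assms
    by (auto simp: psd_mat_def hermitian_mat_def adjoint_mat_def diag_mat_real_def vec_eq_iff
        intro!: sum_nonneg)
qed

text \<open>Hermiticity makes the diagonal real and the unit trace fixes its second entry, which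
  leaves a single real parameter to minimise over.\<close>

lemma incoherent_states_diag:
  assumes "\<iota> \<in> incoherent_states"
  obtains a where "\<iota> = diag_mat_real (\<lambda>i. if i = 1 then a else 1 - a)"
proof -
  from assms have herm: "adjoint_mat \<iota> = \<iota>" and tr: "\<iota> $ 1 $ 1 + \<iota> $ 2 $ 2 = 1"
    and off: "\<iota> $ 1 $ 2 = 0" "\<iota> $ 2 $ 1 = 0"
    by (auto simp: incoherent_states_def density_op_def psd_mat_def hermitian_mat_def trace_def sum_2)
  have "cnj (\<iota> $ 1 $ 1) = \<iota> $ 1 $ 1"
    using herm by (auto simp: adjoint_mat_def vec_eq_iff)
  then obtain a where a: "\<iota> $ 1 $ 1 = complex_of_real a"
    by (metis Reals_cnj_iff Reals_cases)
  with tr have "\<iota> $ 2 $ 2 = complex_of_real (1 - a)" by (simp add: algebra_simps)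
  with a off have "\<iota> = diag_mat_real (\<lambda>i. if i = 1 then a else 1 - a)"
    by (simp add: vec_eq_iff forall_2 diag_mat_real_def)
  then show thesis by (rule that)
qed

lemma diag_mat_real_incoherent:
  assumes "0 \<le> a" "a \<le> 1"
  shows "diag_mat_real (\<lambda>i. if i = 1 then a else 1 - a) \<in> incoherent_states"
  using assms psd_mat_diag_mat_real[of "\<lambda>i::2. if i = 1 then a else 1 - a"]
  by (auto simp: incoherent_states_def density_op_def trace_def sum_2 diag_mat_real_def)

theorem mainTheorem1:
  fixes p r1 r2 r3 :: real and \<rho> :: "complex^2^2"
  assumes "0 < p"
    and "density_op \<rho>"
    and "\<rho> = (1/2) *\<^sub>R (mat 1 + r1 *\<^sub>R pauli1 + r2 *\<^sub>R pauli2 + r3 *\<^sub>R pauli3)"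
  shows "(\<exists>\<iota>\<in>incoherent_states. schatten_norm p (\<rho> - \<iota>) = coherence p \<rho> \<and>
            (\<forall>\<iota>'\<in>incoherent_states. schatten_norm p (\<rho> - \<iota>) \<le> schatten_norm p (\<rho> - \<iota>')))
         \<and> coherence p \<rho> = 2 powr ((1 - p) / p) * sqrt (r1\<^sup>2 + r2\<^sup>2)"
proof -
  define D :: "real \<Rightarrow> complex^2^2" where "D a = diag_mat_real (\<lambda>i. if i = 1 then a else 1 - a)" for a
  \<comment> \<open>The upper left entry of \<rho>, so \<open>D a0\<close> is \<rho> without its
    off-diagonal entries. With \<open>a = (1 + t) / 2\<close> the difference \<open>a0 - a\<close>
    is \<open>(r3 - t) / 2\<close>.\<close>
  define a0 where "a0 = (1 + r3) / 2"
  have \<rho>: "\<rho> $ 1 $ 1 = complex_of_real a0" "\<rho> $ 2 $ 2 = complex_of_real (1 - a0)"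
    "\<rho> $ 1 $ 2 = Complex (r1 / 2) (- r2 / 2)" "\<rho> $ 2 $ 1 = Complex (r1 / 2) (r2 / 2)"
    by (simp_all add: assms(3) a0_def pauli1_def pauli2_def pauli3_def mat_def complex_eq_iff)
       (simp_all add: field_simps)
  have norm: "schatten_norm p (\<rho> - D a) = 2 powr (1 / p) * sqrt ((a0 - a)\<^sup>2 + (r1\<^sup>2 + r2\<^sup>2) / 4)" for a
  proof -
    have "schatten_norm p (\<rho> - D a)
        = 2 powr (1 / p) * sqrt ((a0 - a)\<^sup>2 + (cmod ((\<rho> - D a) $ 1 $ 2))\<^sup>2)"
      by (rule schatten_norm_hermitian_traceless)
         (use assms(1) in \<open>simp_all add: \<rho> D_def diag_mat_real_def complex_eq_iff\<close>)
    also have "(cmod ((\<rho> - D a) $ 1 $ 2))\<^sup>2 = (r1\<^sup>2 + r2\<^sup>2) / 4"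
      by (simp add: \<rho> D_def diag_mat_real_def cmod_power2 field_simps)
    finally show ?thesis .
  qed
  \<comment> \<open>The diagonal entries of \<rho> are \<open>a0\<close> and \<open>1 - a0\<close>,
    both nonnegative by positivity.\<close>
  have "0 \<le> a0" "a0 \<le> 1"
    using psd_mat_diag_nonneg[of \<rho> 1] psd_mat_diag_nonneg[of \<rho> 2] assms(2)
    by (auto simp: density_op_def \<rho>)
  then have D0: "D a0 \<in> incoherent_states"
    unfolding D_def by (rule diag_mat_real_incoherent)
  have least: "schatten_norm p (\<rho> - D a0) \<le> schatten_norm p (\<rho> - \<iota>)"
    if \<iota>: "\<iota> \<in> incoherent_states" for \<iota>
  proof -
    obtain a where "\<iota> = D a" unfolding D_def by (rule incoherent_states_diag[OF \<iota>])
    \<comment> \<open>Only the square \<open>(a0 - a)^2\<close> under the root depends on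
      \<open>a\<close>, and it vanishes at \<open>a = a0\<close>.\<close>
    then show ?thesis by (simp add: norm)
  qed
  have "coherence p \<rho> = schatten_norm p (\<rho> - D a0)"
    unfolding coherence_def using D0 least by (intro cInf_eq_minimum) auto
  moreover have "schatten_norm p (\<rho> - D a0) = 2 powr ((1 - p) / p) * sqrt (r1\<^sup>2 + r2\<^sup>2)"
  proof -
    \<comment> \<open>The exponent is \<open>1 / p - 1\<close>; the lost factor 2 is the root of the
      4 that divides \<open>r1^2 + r2^2\<close> in \<open>norm\<close>.\<close>
    have "2 powr ((1 - p) / p) = 2 powr (1 / p) / (2::real)"
      using assms(1) by (simp add: diff_divide_distrib powr_diff)
    then show ?thesis by (simp add: norm real_sqrt_divide)
  qed
  ultimately show ?thesis using D0 least by auto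
qed

end
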